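(* Let $q$ be a power of an odd prime with $q\equiv 1\pmod 3$, and let $\zeta\in\mathbb{F}_q^{\ast}$ be an element of order $3$. Let $m,d$ be positive integers with $q-1=md$, $d\equiv 0\pmod 3$ and $\varphi(m)\ge 3$. Let $u,v,w\in\mathbb{F}_q^{\ast}$ be three elements, not all equal, each of multiplicative order $m$. Put $a=(u+v\zeta+w\zeta^2)/3$, $b=(u+v\zeta^2+w\zeta)/3$, $c=(u+v+w)/3$ and $f(x)=ax^{(2q+1)/3}+bx^{(q+2)/3}+cx$. Then: (i) $f$ is a permutation polynomial of $\mathbb{F}_q$; (ii) the permutation induced by $f$ has cycle type $1+m^d$; (iii) the inverse permutation is induced by the trinomial $a'x^{(2q+1)/3}+b'x^{(q+2)/3}+c'x$, where $a'=(u^{-1}+v^{-1}\zeta+w^{-1}\zeta^2)/3$, $b'=(u^{-1}+v^{-1}\zeta^2+w^{-1}\zeta)/3$ and $c'=(u^{-1}+v^{-1}+w^{-1})/3$.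
   Context: $\varphi$ denotes Euler's totient function. The order of a nonzero element means its order in $\mathbb{F}_q^{\ast}$. Cycle type $1+m^d$ means the permutation has exactly one fixed point and its remaining elements form $d$ disjoint cycles each of length $m$. *)

theory Defs
  imports
    "HOL-Algebra.Multiplicative_Group"
    "HOL-Number_Theory.Cong"
    "HOL-Number_Theory.Totient"
    "HOL-Combinatorics.Orbits"
    "HOL-Library.Disjoint_Sets"
    "HOL-Library.Cardinality"
    "HOL-Computational_Algebra.Polynomial"
begin

definition unit_group :: "'a::field monoid" where
  "unit_group = \<lparr> carrier = UNIV - {0}, monoid.mult = (*), one = 1 \<rparr>"

lemma group_unit_group: "group (unit_group :: 'a::field monoid)"
proof (rule groupI)
  fix x :: 'a assume "x \<in> carrier unit_group"
  then show "\<exists>y\<in>carrier unit_group. y \<otimes>\<^bsub>unit_group\<^esub> x = \<one>\<^bsub>unit_group\<^esub>"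
    by (auto simp: unit_group_def intro!: bexI[of _ "inverse x"])
qed (auto simp: unit_group_def)

definition mult_order :: "'a::field \<Rightarrow> nat" where
  "mult_order x = group.ord unit_group x"

lemma pow_unit_group: "x [^]\<^bsub>unit_group\<^esub> (n::nat) = (x::'a::field) ^ n"
proof (induction n)
  case 0
  then show ?case by (simp add: nat_pow_def unit_group_def)
next
  case (Suc n)
  then show ?case by (simp add: nat_pow_def unit_group_def)
qed

lemma mult_order_dvd_iff:
  fixes x :: "'a::field"
  assumes "x \<noteq> 0"
  shows "x ^ n = 1 \<longleftrightarrow> mult_order x dvd n"
proof -
  have "x \<in> carrier unit_group"
    using assms by (simp add: unit_group_def)
  from group.pow_eq_id[OF group_unit_group this, of n] show ?thesis
    by (simp add: pow_unit_group mult_order_def) (simp add: unit_group_def)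
qed

definition permutation_polynomial :: "'a::finite_field poly \<Rightarrow> bool" where
  "permutation_polynomial f \<longleftrightarrow> bij (poly f)"

text \<open>Cycle type \<open>1 + m\<^sup>d\<close>, with \<open>z\<close> the fixed point and \<open>\<C>\<close> the set of \<open>m\<close>-cycles.\<close>

definition has_cycle_type_one_plus :: "('a::finite \<Rightarrow> 'a) \<Rightarrow> nat \<Rightarrow> nat \<Rightarrow> bool" where
  "has_cycle_type_one_plus \<pi> m d \<longleftrightarrow>
     bij \<pi> \<and>
     (\<exists>z \<C>. {x. \<pi> x = x} = {z} \<and>
            partition_on (UNIV - {z}) \<C> \<and>
            card \<C> = d \<and>
            (\<forall>C\<in>\<C>. cyclic_on \<pi> C \<and> card C = m))"

end

theory Submission
  imports Defs
begin

text \<open>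
  Put \<open>s = (q - 1) / 3\<close>. For \<open>x \<noteq> 0\<close> the power \<open>x ^ s\<close> is one of \<open>1, \<zeta>, \<zeta>\<^sup>2\<close>, and
  \<open>f(x) = x * (a * x ^ (2 * s) + b * x ^ s + c)\<close> is \<open>u * x\<close>, \<open>v * x\<close> or \<open>w * x\<close> accordingly:
  \<open>a, b, c\<close> interpolate \<open>u, v, w\<close> at the cube roots of unity. Because \<open>m\<close> divides \<open>s\<close>, each of
  \<open>u, v, w\<close> is an \<open>s\<close>-th root of unity, so \<open>f\<close> preserves \<open>x ^ s\<close>. Hence \<open>f\<close> acts on each of the
  three classes as multiplication by a fixed element of order \<open>m\<close>, and its inverse multiplies by
  the inverse element.
\<close>

text \<open>The weight is constant along the orbit of \<open>x\<close>, so each iteration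
  contributes the same factor \<open>e x\<close>.\<close>

lemma funpow_weighted_mult:
  fixes e :: "'a::comm_monoid_mult \<Rightarrow> 'a"
  assumes "\<And>x. e (e x * x) = e x"
  shows "((\<lambda>x. e x * x) ^^ n) x = e x ^ n * x"
proof -
  have "((\<lambda>x. e x * x) ^^ n) x = e x ^ n * x \<and> e (e x ^ n * x) = e x"
  proof (induction n)
    case (Suc n)
    have "e x ^ Suc n * x = e (e x ^ n * x) * (e x ^ n * x)"
      using Suc by (simp add: mult.assoc)
    with Suc assms[of "e x ^ n * x"] show ?case by simp
  qed simp
  then show ?thesis ..
qed

lemma inj_on_power_mult_order:
  fixes x :: "'a::field"
  assumes "x \<noteq> 0"
  shows "inj_on (\<lambda>n. x ^ n) {..<mult_order x}"
proof (rule linorder_inj_onI)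
  fix i j assume "i < j" "i \<in> {..<mult_order x}" "j \<in> {..<mult_order x}"
  then have "\<not> mult_order x dvd j - i" by (auto dest: dvd_imp_le)
  then have "x ^ (j - i) \<noteq> 1" using mult_order_dvd_iff[OF assms] by simp
  moreover have "x ^ j = x ^ i * x ^ (j - i)"
    using \<open>i < j\<close> by (simp flip: power_add)
  ultimately show "x ^ i \<noteq> x ^ j" using assms by simp
qed auto

lemma orbit_weighted_mult:
  fixes e :: "'a::field \<Rightarrow> 'a"
  assumes inv: "\<And>x. e (e x * x) = e x"
    and "e x \<noteq> 0" and "mult_order (e x) = m" and "m > 0"
  shows "orbit (\<lambda>x. e x * x) x = (\<lambda>n. e x ^ n * x) ` {..<m}"
proof -
  have "((\<lambda>x. e x * x) ^^ m) x = x"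
    using assms mult_order_dvd_iff[of "e x" m] by (simp add: funpow_weighted_mult[where e = e])
  from orbit_altdef_bounded[OF this \<open>m > 0\<close>] show ?thesis
    by (auto simp: funpow_weighted_mult[where e = e, OF inv])
qed

text \<open>The orbit of a nonzero \<open>x\<close> is the coset of \<open>x\<close> under the group
  of order \<open>m\<close> generated by \<open>e x\<close>. No weight is \<open>1\<close>, since
  \<open>m > 1\<close>, so \<open>0\<close> is the only fixed point.\<close>

lemma has_cycle_type_weighted_mult:
  fixes e :: "'a::finite_field \<Rightarrow> 'a"
  assumes inv: "\<And>x. e (e x * x) = e x"
    and nz: "\<And>x. e x \<noteq> 0" and ord: "\<And>x. mult_order (e x) = m"
    and "m > 1" and card: "CARD('a) - 1 = m * d" and bij: "bij (\<lambda>x. e x * x)"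
  shows "has_cycle_type_one_plus (\<lambda>x. e x * x) m d"
proof -
  let ?p = "\<lambda>x. e x * x"
  let ?C = "orbit ?p ` (UNIV - {0})"
  have "m > 0" using \<open>m > 1\<close> by simp
  note orb = orbit_weighted_mult[where e = e, OF inv nz ord \<open>m > 0\<close>]
  \<comment> \<open>\<open>orbit\<close> starts at the first image, not at \<open>x\<close>; a
    permutation of a finite set returns to \<open>x\<close>.\<close>
  have "permutation ?p" using bij by (simp add: permutation)
  then have self: "x \<in> orbit ?p x" for x by (rule permutation_self_in_orbit)
  have cyc: "cyclic_on ?p (orbit ?p x)" for x
    using self by (auto simp: cyclic_on_def)
  have cardC: "card (orbit ?p x) = m" if "x \<noteq> 0" for x
  proof -
    have "inj_on (\<lambda>n. e x ^ n * x) {..<m}"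
      using inj_on_power_mult_order[OF nz, of x] that by (simp add: ord inj_on_def)
    then show ?thesis by (simp add: orb card_image)
  qed
  have part: "partition_on (UNIV - {0}) ?C"
  proof (rule partition_onI)
    show "\<Union> ?C = UNIV - {0}"
      using self by (auto simp: orb nz)
    fix A B assume "A \<in> ?C" "B \<in> ?C" and "A \<noteq> B"
    then have "cyclic_on ?p A" "cyclic_on ?p B" using cyc by auto
    then show "disjnt A B"
      using \<open>A \<noteq> B\<close> orbit_cyclic_eq3[of ?p A] orbit_cyclic_eq3[of ?p B] by (auto simp: disjnt_iff)
  next
    show "{} \<notin> ?C" using self by blast
  qed
  \<comment> \<open>Counting the nonzero elements by orbits of size \<open>m\<close> yields the
    number of orbits.\<close>
  have "m * d = card (UNIV - {0::'a})" using card by simp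
  also have "\<dots> = card (\<Union> ?C)" using partition_onD1[OF part] by simp
  also have "\<dots> = (\<Sum>A\<in>?C. card A)"
    using partition_onD2[OF part] by (intro card_Union_disjoint) auto
  also have "\<dots> = (\<Sum>A\<in>?C. m)" using cardC by (intro sum.cong) blast+
  finally have "card ?C = d" using \<open>m > 0\<close> by (simp add: mult.commute)
  moreover have "e x \<noteq> 1" for x
    using mult_order_dvd_iff[OF nz, of x 1] \<open>m > 1\<close> by (simp add: ord)
  then have "{x. ?p x = x} = {0}" by auto
  ultimately show ?thesis
    unfolding has_cycle_type_one_plus_def
    using bij part cyc cardC by (intro conjI exI[of _ 0] exI[of _ ?C]) auto
qed

text \<open>Cancelling \<open>z - 1\<close> in \<open>z ^ 3 - 1 = 0\<close> gives the quadratic. In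
  characteristic 3 that quadratic is the square of \<open>z - 1\<close>, which would force
  \<open>z = 1\<close>.\<close>

lemma mult_order_3_cube_root:
  fixes z :: "'a::field"
  assumes "z \<noteq> 0" and "mult_order z = 3"
  shows "z\<^sup>2 + z + 1 = 0" and "(3::'a) \<noteq> 0"
proof -
  have "z ^ 3 = 1" "z \<noteq> 1"
    using mult_order_dvd_iff[OF assms(1), of 3] mult_order_dvd_iff[OF assms(1), of 1] assms(2)
    by auto
  have "(z - 1) * (z\<^sup>2 + z + 1) = z ^ 3 - 1" by Groebner_Basis.algebra
  then show sum: "z\<^sup>2 + z + 1 = 0" using \<open>z ^ 3 = 1\<close> \<open>z \<noteq> 1\<close> by simp
  have "(z - 1)\<^sup>2 = (z\<^sup>2 + z + 1) - 3 * z" by Groebner_Basis.algebra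
  then show "(3::'a) \<noteq> 0" using sum \<open>z \<noteq> 1\<close> by auto
qed

text \<open>The last branch stands for \<open>x ^ s = z\<^sup>2\<close>. Being total, the weight is
  one of \<open>u\<close>, \<open>v\<close>, \<open>w\<close> even at \<open>x = 0\<close>.\<close>

definition cubic_weight :: "nat \<Rightarrow> 'a::field \<Rightarrow> 'a \<Rightarrow> 'a \<Rightarrow> 'a \<Rightarrow> 'a \<Rightarrow> 'a" where
  "cubic_weight s z u v w x = (if x ^ s = 1 then u else if x ^ s = z then v else w)"

text \<open>The coefficients are the inverse discrete Fourier transform of \<open>u\<close>,
  \<open>v\<close>, \<open>w\<close> over the cube roots of unity. With arbitrary values the lemma
  serves both \<open>f\<close> and its inverse.\<close>

lemma poly_trinomial_eq_cubic_weight: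
  fixes z u v w x :: "'a::finite_field"
  assumes "z \<noteq> 0" and "mult_order z = 3" and card: "CARD('a) = 3 * s + 1"
  shows "poly (monom ((u + v * z + w * z\<^sup>2) / 3) (2 * s + 1) +
               monom ((u + v * z\<^sup>2 + w * z) / 3) (s + 1) +
               monom ((u + v + w) / 3) 1) x = cubic_weight s z u v w x * x"
    (is "poly ?f x = _")
proof (cases "x = 0")
  case False
  note z = mult_order_3_cube_root(1)[OF assms(1,2)]
  note three = mult_order_3_cube_root(2)[OF assms(1,2)]
  define y where "y = x ^ s"
  have "x ^ (3 * s) * x = x"
    using finite_field_power_card_eq_same[of x] by (simp add: card mult.commute)
  then have "y ^ 3 = 1"
    using False by (simp add: y_def mult.commute flip: power_mult)
  then have "(y - 1) * (y - z) * (y - z\<^sup>2) = 0"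
    using z by Groebner_Basis.algebra
  then have y: "y = 1 \<or> y = z \<or> y = z\<^sup>2" by auto
  have ne: "z \<noteq> 1" "z\<^sup>2 \<noteq> 1" "z\<^sup>2 \<noteq> z"
    using mult_order_dvd_iff[OF assms(1), of 1] mult_order_dvd_iff[OF assms(1), of 2] assms(1,2)
    by (auto simp: power2_eq_square)
  let ?r = "(u + v * z + w * z\<^sup>2) * y\<^sup>2 + (u + v * z\<^sup>2 + w * z) * y + (u + v + w)"
  have "x ^ (2 * s + 1) = y\<^sup>2 * x" "x ^ (s + 1) = y * x"
    by (simp_all add: y_def power_even_eq)
  then have "poly ?f x = ?r / 3 * x"
    by (simp only: poly_add poly_monom) (simp add: distrib_right add_divide_distrib mult.assoc)
  moreover have "?r = 3 * cubic_weight s z u v w x"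
  proof -
    consider "y = 1" | "y = z" | "y = z\<^sup>2" using y by blast
    then show ?thesis
    proof cases
      case 1
      then have "cubic_weight s z u v w x = u" by (simp add: cubic_weight_def y_def)
      moreover have "?r = 3 * u" using 1 z by Groebner_Basis.algebra
      ultimately show ?thesis by simp
    next
      case 2
      then have "cubic_weight s z u v w x = v" using ne by (simp add: cubic_weight_def y_def)
      \<comment> \<open>The cofactor comes from dividing the coefficients of \<open>u\<close>,
        \<open>v\<close>, \<open>w\<close>, as polynomials in \<open>z\<close>, by
        \<open>z\<^sup>2 + z + 1\<close>; the remainders are 0, 3, 0.\<close>
      moreover have "?r = (z\<^sup>2 + z + 1) * (u + 2 * v * (z - 1) + w * (z\<^sup>2 - z + 1)) + 3 * v"
        unfolding 2 by Groebner_Basis.algebra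
      then have "?r = 3 * v" by (simp add: z)
      ultimately show ?thesis by simp
    next
      case 3
      then have "cubic_weight s z u v w x = w" using ne by (simp add: cubic_weight_def y_def)
      moreover have "?r = (z\<^sup>2 + z + 1) *
          (u * (z\<^sup>2 - z + 1) + v * (z ^ 3 - z + 1) + w * (z - 1) * (z ^ 3 + 2)) + 3 * w"
        unfolding 3 by Groebner_Basis.algebra
      then have "?r = 3 * w" by (simp add: z)
      ultimately show ?thesis by simp
    qed
  qed
  ultimately have "poly ?f x = 3 * cubic_weight s z u v w x / 3 * x" by (simp only:)
  then show ?thesis using three by simp
qed (simp add: poly_monom)

theorem mainTheorem3:
  fixes \<zeta> u v w a b c a' b' c' :: "'a::finite_field"
    and p k q m d :: nat
    and f g :: "'a poly"
  assumes "prime p" and "odd p" and "k \<ge> 1" and "q = p ^ k"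
    and "CARD('a) = q"
    and "[q = 1] (mod 3)"
    and "\<zeta> \<noteq> 0" and "mult_order \<zeta> = 3"
    and "m > 0" and "d > 0" and "q - 1 = m * d"
    and "[d = 0] (mod 3)" and "totient m \<ge> 3"
    and "u \<noteq> 0" and "v \<noteq> 0" and "w \<noteq> 0"
    and "\<not> (u = v \<and> v = w)"
    and "mult_order u = m" and "mult_order v = m" and "mult_order w = m"
    and "a = (u + v * \<zeta> + w * \<zeta>\<^sup>2) / 3"
    and "b = (u + v * \<zeta>\<^sup>2 + w * \<zeta>) / 3"
    and "c = (u + v + w) / 3"
    and "f = monom a ((2 * q + 1) div 3) + monom b ((q + 2) div 3) + monom c 1"
    and "a' = (inverse u + inverse v * \<zeta> + inverse w * \<zeta>\<^sup>2) / 3"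
    and "b' = (inverse u + inverse v * \<zeta>\<^sup>2 + inverse w * \<zeta>) / 3"
    and "c' = (inverse u + inverse v + inverse w) / 3"
    and "g = monom a' ((2 * q + 1) div 3) + monom b' ((q + 2) div 3) + monom c' 1"
  shows "permutation_polynomial f
       \<and> has_cycle_type_one_plus (poly f) m d
       \<and> inv_into UNIV (poly f) = poly g"
proof -
  obtain d' where d': "d = 3 * d'"
    using \<open>[d = 0] (mod 3)\<close> by (auto simp: cong_0_iff)
  \<comment> \<open>This is \<open>(q - 1) / 3\<close>; divisibility of \<open>d\<close> by 3 makes
    it a multiple of \<open>m\<close>.\<close>
  define s where "s = m * d'"
  have "q > 0" using \<open>CARD('a) = q\<close> by (metis zero_less_card_finite)
  then have q: "q = 3 * s + 1" using \<open>q - 1 = m * d\<close> by (simp add: s_def d')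
  then have card: "CARD('a) = 3 * s + 1" using \<open>CARD('a) = q\<close> by simp
  have expo: "(2 * q + 1) div 3 = 2 * s + 1" "(q + 2) div 3 = s + 1"
    by (auto simp: q)
  define e where "e = cubic_weight s \<zeta> u v w"
  note trinomial = poly_trinomial_eq_cubic_weight[OF \<open>\<zeta> \<noteq> 0\<close> \<open>mult_order \<zeta> = 3\<close> card]
  have f: "poly f = (\<lambda>x. e x * x)"
    unfolding assms(21-24) expo e_def by (rule ext) (rule trinomial)
  have inverse_e: "cubic_weight s \<zeta> (inverse u) (inverse v) (inverse w) x = inverse (e x)" for x
    by (simp add: e_def cubic_weight_def)
  have g: "poly g = (\<lambda>x. inverse (e x) * x)"
    unfolding assms(25-28) expo inverse_e[symmetric] by (rule ext) (rule trinomial)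
  have nz: "e x \<noteq> 0" and ord: "mult_order (e x) = m" for x
    using assms(14-16,18-20) by (auto simp: e_def cubic_weight_def)
  have es: "e x ^ s = 1" for x
    using mult_order_dvd_iff[OF nz, of x s] by (simp add: ord s_def)
  have e_cong: "e y = e x" if "y ^ s = x ^ s" for x y
    using that by (simp add: e_def cubic_weight_def)
  have inv: "e (e x * x) = e x" for x
    by (rule e_cong) (simp add: power_mult_distrib es)
  \<comment> \<open>The candidate inverse also preserves the class of \<open>x\<close>, so the two
    weights cancel in either order of composition.\<close>
  have inv': "e (inverse (e x) * x) = e x" for x
    by (rule e_cong) (simp add: power_mult_distrib power_inverse es)
  have fg: "poly f \<circ> poly g = id" and gf: "poly g \<circ> poly f = id"
    by (auto simp: f g fun_eq_iff inv inv' nz)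
  then have bij: "bij (poly f)" by (auto intro: o_bij)
  \<comment> \<open>The totients of 0 and 1 are below 3.\<close>
  have "m > 1" using \<open>totient m \<ge> 3\<close> by (cases "m = 1"; cases "m = 0") auto
  have "CARD('a) - 1 = m * d" using \<open>CARD('a) = q\<close> \<open>q - 1 = m * d\<close> by simp
  have "has_cycle_type_one_plus (poly f) m d"
    unfolding f
    by (rule has_cycle_type_weighted_mult) (fact inv nz ord \<open>m > 1\<close> \<open>CARD('a) - 1 = m * d\<close> bij[unfolded f])+
  moreover have "inv_into UNIV (poly f) = poly g"
    using gf fg by (rule inv_unique_comp[rotated])
  ultimately show ?thesis
    using bij by (simp add: permutation_polynomial_def)
qed

end
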